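(* For each $n\ge1$ let $(X_{n,j})_{1\le j\le n}$ be centered, square integrable real random variables adapted to $\sigma$-fields $(\mathcal{F}_{n,j})_{1\le j\le n}$ with $\mathcal{F}_{n,j}\subset\mathcal{F}_{n,j+1}$ for all $1\le j\le n-1$, and put $X_{n,0}=0$, $\mathcal{F}_{n,0}=\{\varnothing,\Omega\}$. Let $S_{n,j}=\sum_{i=1}^j X_{n,i}$, $S_n=S_{n,n}$, and for $0\le j\le n$ $$A_{n,j}=\mathbf{E}(S_n-S_{n,j}\mid\mathcal{F}_{n,j}).$$ Assume $\mathbf{E}S_n^2=1$ for all $n$, $$\max_{1\le j\le n}\big(|X_{n,j}|+|A_{n,j}|\big)\to 0\quad\text{in probability as } n\to\infty,$$ and $$\sum_{j=1}^n\big(X_{n,j}^2+2X_{n,j}A_{n,j}\big)\to 1\quad\text{in probability as } n\to\infty.$$ Then $S_n$ converges in distribution to $N(0,1)$.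
   Context: All random variables are defined on a probability space $(\Omega,\mathcal{K},\mathbf{P})$ and all $\mathcal{F}_{n,j}$ are sub-$\sigma$-fields of $\mathcal{K}$. Adapted means that $X_{n,j}$ is $\mathcal{F}_{n,j}$-measurable. $N(0,1)$ is the standard normal law. *)

theory Defs
  imports "HOL-Probability.Probability"
begin

definition partial_sum :: "(nat \<Rightarrow> nat \<Rightarrow> 'a \<Rightarrow> real) \<Rightarrow> nat \<Rightarrow> nat \<Rightarrow> 'a \<Rightarrow> real" where
  "partial_sum X n j = (\<lambda>\<omega>. \<Sum>i = 1..j. X n i \<omega>)"

text \<open>The \<open>\<sigma>\<close>-fields are represented by measures \<open>F n j\<close> of which only the space and the
  measurable sets matter; conditional expectations are taken with respect to the measure of \<open>M\<close>.\<close>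

definition cond_remainder ::
    "'a measure \<Rightarrow> (nat \<Rightarrow> nat \<Rightarrow> 'a measure) \<Rightarrow> (nat \<Rightarrow> nat \<Rightarrow> 'a \<Rightarrow> real) \<Rightarrow> nat \<Rightarrow> nat \<Rightarrow> 'a \<Rightarrow> real" where
  "cond_remainder M F X n j =
     real_cond_exp M (F n j) (\<lambda>\<omega>. partial_sum X n n \<omega> - partial_sum X n j \<omega>)"

text \<open>Intended for random variables \<open>Y n\<close> and \<open>Z\<close>: for events that fail to be measurable,
  \<open>measure\<close> would return \<open>0\<close>.\<close>

definition tendsto_in_prob :: "'a measure \<Rightarrow> (nat \<Rightarrow> 'a \<Rightarrow> real) \<Rightarrow> ('a \<Rightarrow> real) \<Rightarrow> bool" where
  "tendsto_in_prob M Y Z \<longleftrightarrow>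
     (\<forall>\<epsilon>>0. (\<lambda>n. measure M {\<omega> \<in> space M. \<bar>Y n \<omega> - Z \<omega>\<bar> > \<epsilon>}) \<longlonglongrightarrow> 0)"

end

theory Submission
  imports Defs
begin

text \<open>
  The variables \<open>S\<^sub>j + A\<^sub>j = E(S\<^sub>n | F\<^sub>j)\<close> form a martingale that starts at \<open>0\<close> and ends at \<open>S\<^sub>n\<close>; let
  \<open>D\<^sub>j = X\<^sub>j + A\<^sub>j - A\<^sub>j\<^sub>-\<^sub>1\<close> be its increments. Expanding squares and telescoping gives
  \<open>\<Sum> (X\<^sub>j\<^sup>2 + 2 X\<^sub>j A\<^sub>j) = \<Sum> D\<^sub>j\<^sup>2 + 2 \<Sum> A\<^sub>j\<^sub>-\<^sub>1 D\<^sub>j\<close>. The last sum tends to \<open>0\<close> in probability: after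
  truncating \<open>A\<^sub>j\<^sub>-\<^sub>1\<close> at a small level \<open>\<gamma>\<close> it is a martingale transform of second moment at most \<open>\<gamma>\<^sup>2\<close>.
  Hence \<open>\<Sum> D\<^sub>j\<^sup>2\<close> tends to \<open>1\<close> and \<open>max |D\<^sub>j|\<close> to \<open>0\<close>, both in probability.

  The central limit theorem for the \<open>D\<^sub>j\<close> is proved by McLeish's method. When the \<open>D\<^sub>j\<close> are small and
  their squares sum to about \<open>1\<close>, \<open>exp(i t S\<^sub>n)\<close> is close to \<open>exp(-t\<^sup>2/2) \<Prod> (1 + i t D\<^sub>j)\<close>. The product,
  suitably stopped, has expectation \<open>1\<close> and bounded second moment, so the exceptional event is
  negligible in the limit and the characteristic function of \<open>S\<^sub>n\<close> tends to \<open>exp(-t\<^sup>2/2)\<close>.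
\<close>

section \<open>Elementary estimates for complex exponentials and products\<close>

text \<open>The squared modulus is (1 + x^2) exp(-x^2), and 1 + y \<le> exp y. Factors of modulus at
  most 1 are what the factor-by-factor comparison of two products requires.\<close>

lemma norm_one_plus_ii_mult_exp_le:
  fixes x :: real
  shows "cmod ((1 + \<i> * of_real x) * of_real (exp (- (x\<^sup>2) / 2))) \<le> 1"
proof -
  have "(cmod ((1 + \<i> * of_real x) * of_real (exp (- (x\<^sup>2) / 2))))\<^sup>2 = (1 + x\<^sup>2) * exp (- (x\<^sup>2))"
    by (simp add: norm_mult power_mult_distrib cmod_power2 flip: exp_double)
  also have "\<dots> \<le> exp (x\<^sup>2) * exp (- (x\<^sup>2))"
    by (intro mult_right_mono exp_ge_add_one_self) simp
  also have "\<dots> = 1"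
    by (simp flip: exp_add)
  finally show ?thesis
    by (simp add: power2_le_iff_abs_le abs_square_le_1)
qed

text \<open>Both terms have the second order expansion 1 + ix - x^2/2, so their difference is cubic.
  The three error contributions are 1/6, 1/2 and 1/2 times |x|^3; the constant 2 is a rounding
  up.\<close>

lemma norm_iexp_minus_le:
  fixes x :: real
  assumes "\<bar>x\<bar> \<le> 1"
  shows "cmod (iexp x - (1 + \<i> * of_real x) * of_real (exp (- (x\<^sup>2) / 2))) \<le> 2 * \<bar>x\<bar> ^ 3"
proof -
  define u where "u = x\<^sup>2 / 2"
  define r where "r = exp (- u) - (1 - u)"
  have u0: "0 \<le> u" by (simp add: u_def)
  \<comment> \<open>With 1 + u \<le> exp u, this factorization of 1 + u^3 yields the upper bound
    exp(-u) \<le> 1 - u + u^2 for u \<ge> 0.\<close>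
  have "(1 - u + u\<^sup>2) * (1 + u) = 1 + u ^ 3" by (simp add: algebra_simps power2_eq_square power3_eq_cube)
  then have "1 \<le> (1 - u + u\<^sup>2) * (1 + u)" using u0 by simp
  also have "\<dots> \<le> (1 - u + u\<^sup>2) * exp u"
  proof (rule mult_left_mono)
    have "0 \<le> (1 - u)\<^sup>2 + u" using u0 by simp
    then show "0 \<le> 1 - u + u\<^sup>2" by (simp add: power2_eq_square algebra_simps)
  qed simp
  finally have "exp (- u) \<le> 1 - u + u\<^sup>2"
    by (simp add: exp_minus field_simps)
  moreover have "1 - u \<le> exp (- u)" using exp_ge_add_one_self[of "- u"] by simp
  ultimately have r: "\<bar>r\<bar> \<le> u\<^sup>2" by (simp add: r_def)
  have u2: "u\<^sup>2 \<le> \<bar>x\<bar> ^ 3 / 4"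
  proof -
    have "u\<^sup>2 = \<bar>x\<bar> ^ 3 * \<bar>x\<bar> / 4"
      by (simp add: u_def power_divide flip: power_mult power_Suc2)
    also have "\<dots> \<le> \<bar>x\<bar> ^ 3 * 1 / 4" by (intro divide_right_mono mult_left_mono assms) auto
    finally show ?thesis by simp
  qed
  have 1: "cmod (iexp x - (1 + \<i> * of_real x - of_real u)) \<le> \<bar>x\<bar> ^ 3 / 6"
    using iexp_approx1[of x 2]
    by (simp add: u_def eval_nat_numeral algebra_simps)
  \<comment> \<open>Write exp(-u) as 1 - u + r and multiply out: beyond the second order Taylor
    error there remain the cross term ixu and the remainder (1 + ix) r.\<close>
  have eq: "iexp x - (1 + \<i> * of_real x) * of_real (exp (- (x\<^sup>2) / 2))
     = (iexp x - (1 + \<i> * of_real x - of_real u)) + (\<i> * of_real (x * u) - (1 + \<i> * of_real x) * of_real r)"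
    by (simp add: r_def u_def algebra_simps)
  have 2: "cmod (\<i> * of_real (x * u)) = \<bar>x\<bar> ^ 3 / 2"
    by (simp add: norm_mult u_def power2_eq_square power3_eq_cube abs_mult)
  have "cmod (1 + \<i> * of_real x) \<le> 1 + \<bar>x\<bar>"
    using norm_triangle_ineq[of 1 "\<i> * of_real x"] by (simp add: norm_mult)
  then have "cmod ((1 + \<i> * of_real x) * of_real r) \<le> 2 * u\<^sup>2"
    using r assms unfolding norm_mult by (intro mult_mono) auto
  then have 3: "cmod ((1 + \<i> * of_real x) * of_real r) \<le> \<bar>x\<bar> ^ 3 / 2" using u2 by simp
  have "cmod (iexp x - (1 + \<i> * of_real x) * of_real (exp (- (x\<^sup>2) / 2)))
     \<le> \<bar>x\<bar> ^ 3 / 6 + (\<bar>x\<bar> ^ 3 / 2 + \<bar>x\<bar> ^ 3 / 2)"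
    unfolding eq by (intro order_trans[OF norm_triangle_ineq] add_mono 1
        order_trans[OF norm_triangle_ineq4] 2[THEN eq_refl] 3)
  also have "\<dots> \<le> 2 * \<bar>x\<bar> ^ 3" by simp
  finally show ?thesis .
qed

text \<open>The comparison passes through \<open>P\<close>, the product of 1 + itd times
  exp(-(td)^2/2). Each exponential is close to its factor of \<open>P\<close>, and the Gaussian
  factors of \<open>P\<close> combine to exp(-t^2 V/2), where \<open>V\<close> is within \<delta> of
  1.\<close>

lemma norm_iexp_sum_minus_prod_le:
  fixes d :: "'i \<Rightarrow> real"
  assumes "finite I" and small: "\<And>j. j \<in> I \<Longrightarrow> \<bar>d j\<bar> \<le> \<delta>" and "\<bar>t\<bar> * \<delta> \<le> 1" "0 \<le> \<delta>" "\<delta> \<le> 1"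
    and squares: "\<bar>(\<Sum>j\<in>I. (d j)\<^sup>2) - 1\<bar> \<le> \<delta>"
  shows "cmod (iexp (t * (\<Sum>j\<in>I. d j)) - of_real (exp (- (t\<^sup>2) / 2)) * (\<Prod>j\<in>I. 1 + \<i> * of_real (t * d j)))
     \<le> 4 * \<bar>t\<bar> ^ 3 * \<delta> + (exp (t\<^sup>2 * \<delta> / 2) - 1)"
proof -
  define V where "V = (\<Sum>j\<in>I. (d j)\<^sup>2)"
  define P where "P = (\<Prod>j\<in>I. (1 + \<i> * of_real (t * d j)) * of_real (exp (- ((t * d j)\<^sup>2) / 2)))"
  have e: "iexp (t * (\<Sum>j\<in>I. d j)) = (\<Prod>j\<in>I. iexp (t * d j))"
    using \<open>finite I\<close> by (simp add: sum_distrib_left exp_sum)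
  have "(\<Prod>j\<in>I. exp (- ((t * d j)\<^sup>2) / 2)) = exp (- (t\<^sup>2) / 2 * V)"
    using \<open>finite I\<close> by (simp add: exp_sum[symmetric] V_def sum_distrib_left power_mult_distrib)
  then have P: "P = (\<Prod>j\<in>I. 1 + \<i> * of_real (t * d j)) * of_real (exp (- (t\<^sup>2) / 2 * V))"
    unfolding P_def prod.distrib by (simp flip: of_real_prod)
  have "cmod ((\<Prod>j\<in>I. iexp (t * d j)) - P)
      \<le> (\<Sum>j\<in>I. cmod (iexp (t * d j) - (1 + \<i> * of_real (t * d j)) * of_real (exp (- ((t * d j)\<^sup>2) / 2))))"
    unfolding P_def by (intro norm_prod_diff norm_one_plus_ii_mult_exp_le) simp
  \<comment> \<open>One of the three powers of |d| is bounded by \<delta>; the remaining squares sum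
    to \<open>V\<close>, which is at most 1 + \<delta> \<le> 2. This produces the constant
    4.\<close>
  also have "\<dots> \<le> (\<Sum>j\<in>I. 2 * \<bar>t\<bar> ^ 3 * \<delta> * (d j)\<^sup>2)"
  proof (rule sum_mono)
    fix j assume j: "j \<in> I"
    have "\<bar>t * d j\<bar> \<le> \<bar>t\<bar> * \<delta>" using small[OF j] by (simp add: abs_mult mult_left_mono)
    then have "cmod (iexp (t * d j) - (1 + \<i> * of_real (t * d j)) * of_real (exp (- ((t * d j)\<^sup>2) / 2)))
      \<le> 2 * \<bar>t * d j\<bar> ^ 3"
      using assms by (intro norm_iexp_minus_le) auto
    also have "\<dots> = 2 * \<bar>t\<bar> ^ 3 * (\<bar>d j\<bar> * (d j)\<^sup>2)"
      by (simp add: abs_mult power_mult_distrib power3_eq_cube[of "\<bar>d j\<bar>"] power2_eq_square)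
    also have "\<dots> \<le> 2 * \<bar>t\<bar> ^ 3 * (\<delta> * (d j)\<^sup>2)"
      using small[OF j] by (intro mult_left_mono mult_right_mono) auto
    finally show "cmod (iexp (t * d j) - (1 + \<i> * of_real (t * d j)) * of_real (exp (- ((t * d j)\<^sup>2) / 2)))
      \<le> 2 * \<bar>t\<bar> ^ 3 * \<delta> * (d j)\<^sup>2" by (simp add: mult_ac)
  qed
  also have "\<dots> = 2 * \<bar>t\<bar> ^ 3 * \<delta> * V" by (simp add: V_def sum_distrib_left)
  also have "\<dots> \<le> 2 * \<bar>t\<bar> ^ 3 * \<delta> * 2"
    using squares assms by (intro mult_left_mono) (auto simp: V_def)
  finally have 1: "cmod ((\<Prod>j\<in>I. iexp (t * d j)) - P) \<le> 4 * \<bar>t\<bar> ^ 3 * \<delta>" by simp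
  have exp_eq: "exp (- (t\<^sup>2) / 2) = exp (- (t\<^sup>2) / 2 * V) * exp (t\<^sup>2 / 2 * (V - 1))"
    by (simp add: exp_add[symmetric] algebra_simps)
  have "P - of_real (exp (- (t\<^sup>2) / 2)) * (\<Prod>j\<in>I. 1 + \<i> * of_real (t * d j))
      = P * of_real (1 - exp (t\<^sup>2 / 2 * (V - 1)))"
    unfolding P exp_eq by (simp add: algebra_simps)
  then have "cmod (P - of_real (exp (- (t\<^sup>2) / 2)) * (\<Prod>j\<in>I. 1 + \<i> * of_real (t * d j)))
      = cmod P * \<bar>1 - exp (t\<^sup>2 / 2 * (V - 1))\<bar>"
    by (simp only: norm_mult norm_of_real)
  also have "\<dots> \<le> 1 * (exp (t\<^sup>2 * \<delta> / 2) - 1)"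
  proof (rule mult_mono)
    show "cmod P \<le> 1"
      unfolding P_def prod_norm[symmetric] by (intro prod_le_1 conjI norm_one_plus_ii_mult_exp_le norm_ge_zero)
    define a where "a = t\<^sup>2 / 2 * (V - 1)"
    define b where "b = t\<^sup>2 * \<delta> / 2"
    have "t\<^sup>2 / 2 * \<bar>V - 1\<bar> \<le> t\<^sup>2 / 2 * \<delta>"
      using squares by (intro mult_left_mono) (auto simp: V_def)
    then have "\<bar>a\<bar> \<le> b" by (simp add: a_def b_def abs_mult)
    then have "exp a \<le> exp b" "exp (- b) \<le> exp a" by auto
    \<comment> \<open>Turns the lower bound exp(-b) into 1 - exp(-b) \<le> exp b - 1, so the same
      bound serves both signs.\<close>
    moreover have "2 \<le> exp b + exp (- b)"
      using cosh_real_ge_1[of b] by (simp add: cosh_field_def)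
    ultimately show "\<bar>1 - exp (t\<^sup>2 / 2 * (V - 1))\<bar> \<le> exp (t\<^sup>2 * \<delta> / 2) - 1"
      unfolding a_def[symmetric] b_def[symmetric] by linarith
  qed auto
  finally have 2: "cmod (P - of_real (exp (- (t\<^sup>2) / 2)) * (\<Prod>j\<in>I. 1 + \<i> * of_real (t * d j)))
    \<le> exp (t\<^sup>2 * \<delta> / 2) - 1" by simp
  show ?thesis
    unfolding e by (rule norm_diff_triangle_le[OF 1 2])
qed

section \<open>Integrability of products, sums and differences of square integrable
  functions\<close>

lemma integrable_mult_square:
  fixes f g :: "'a \<Rightarrow> real"
  assumes "f \<in> borel_measurable M" "g \<in> borel_measurable M"
    and "integrable M (\<lambda>x. (f x)\<^sup>2)" "integrable M (\<lambda>x. (g x)\<^sup>2)"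
  shows "integrable M (\<lambda>x. f x * g x)"
proof (rule Bochner_Integration.integrable_bound)
  show "integrable M (\<lambda>x. (f x)\<^sup>2 + (g x)\<^sup>2)" using assms by simp
  have "\<bar>a * b\<bar> \<le> a\<^sup>2 + b\<^sup>2" for a b :: real
  proof -
    have "2 * (\<bar>a\<bar> * \<bar>b\<bar>) \<le> a\<^sup>2 + b\<^sup>2"
      using sum_squares_bound[of "\<bar>a\<bar>" "\<bar>b\<bar>"] by (simp add: mult.assoc)
    moreover have "0 \<le> \<bar>a\<bar> * \<bar>b\<bar>" by simp
    ultimately show ?thesis unfolding abs_mult by linarith
  qed
  then show "AE x in M. norm (f x * g x) \<le> norm ((f x)\<^sup>2 + (g x)\<^sup>2)" by simp
qed (use assms in measurable)

lemma integrable_square_add: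
  fixes f g :: "'a \<Rightarrow> real"
  assumes "f \<in> borel_measurable M" "g \<in> borel_measurable M"
    and "integrable M (\<lambda>x. (f x)\<^sup>2)" "integrable M (\<lambda>x. (g x)\<^sup>2)"
  shows "integrable M (\<lambda>x. (f x + g x)\<^sup>2)"
  using assms integrable_mult_square[OF assms] by (simp add: power2_sum mult.assoc)

lemma integrable_square_diff:
  fixes f g :: "'a \<Rightarrow> real"
  assumes "f \<in> borel_measurable M" "g \<in> borel_measurable M"
    and "integrable M (\<lambda>x. (f x)\<^sup>2)" "integrable M (\<lambda>x. (g x)\<^sup>2)"
  shows "integrable M (\<lambda>x. (f x - g x)\<^sup>2)"
  using assms integrable_mult_square[OF assms] by (simp add: power2_diff mult.assoc)

section \<open>Rows of martingale differences and their transforms\<close>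

text \<open>The martingale difference property is expressed by orthogonality to the square integrable
  functions measurable with respect to the past.\<close>

locale mds_row = prob_space M for M :: "'a measure" +
  fixes G :: "nat \<Rightarrow> 'a measure" and d :: "nat \<Rightarrow> 'a \<Rightarrow> real" and n :: nat
  assumes subalg: "\<And>j. j \<le> n \<Longrightarrow> subalgebra M (G j)"
    and filtration: "\<And>j. j < n \<Longrightarrow> sets (G j) \<subseteq> sets (G (Suc j))"
    and adapted: "\<And>j. j < n \<Longrightarrow> d j \<in> borel_measurable (G (Suc j))"
    and square_integrable: "\<And>j. j < n \<Longrightarrow> integrable M (\<lambda>\<omega>. (d j \<omega>)\<^sup>2)"
    and orthogonal: "\<And>j Z. j < n \<Longrightarrow> Z \<in> borel_measurable (G j) \<Longrightarrow>
      integrable M (\<lambda>\<omega>. (Z \<omega>)\<^sup>2) \<Longrightarrow> (\<integral>\<omega>. Z \<omega> * d j \<omega> \<partial>M) = 0"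
begin

lemma measurable_G_mono:
  assumes "i \<le> j" "j \<le> n" "f \<in> measurable (G i) N"
  shows "f \<in> measurable (G j) N"
proof -
  have "sets (G i) \<subseteq> sets (G j)"
    using assms(1,2)
  proof (induction j rule: dec_induct)
    case (step m)
    then show ?case using filtration[of m] by auto
  qed simp
  then have "subalgebra (G j) (G i)"
    using subalg[of i] subalg[of j] assms by (auto simp: subalgebra_def)
  then show ?thesis using assms(3) measurable_from_subalg by blast
qed

lemma measurable_G: "j \<le> n \<Longrightarrow> f \<in> measurable (G j) N \<Longrightarrow> f \<in> measurable M N"
  using measurable_from_subalg subalg by blast

lemma d_measurable_G: "k < j \<Longrightarrow> j \<le> n \<Longrightarrow> d k \<in> borel_measurable (G j)"
  using measurable_G_mono[of "Suc k" j] adapted[of k] by auto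

lemma d_measurable: "k < n \<Longrightarrow> d k \<in> borel_measurable M"
  using d_measurable_G[of k n] measurable_G[of n] by auto

text \<open>McLeish's product is complex valued, so orthogonality is transferred from the real and
  imaginary parts.\<close>

lemma complex_orthogonal:
  fixes Z :: "'a \<Rightarrow> complex"
  assumes "j < n" "Z \<in> borel_measurable (G j)" "integrable M (\<lambda>\<omega>. (cmod (Z \<omega>))\<^sup>2)"
  shows "integrable M (\<lambda>\<omega>. Z \<omega> * of_real (d j \<omega>))"
    and "(\<integral>\<omega>. Z \<omega> * of_real (d j \<omega>) \<partial>M) = 0"
proof -
  have Re: "(\<lambda>\<omega>. Re (Z \<omega>)) \<in> borel_measurable (G j)" "integrable M (\<lambda>\<omega>. (Re (Z \<omega>))\<^sup>2)"
    and Im: "(\<lambda>\<omega>. Im (Z \<omega>)) \<in> borel_measurable (G j)" "integrable M (\<lambda>\<omega>. (Im (Z \<omega>))\<^sup>2)"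
    using assms measurable_G[OF _ assms(2)]
    by (auto intro!: Bochner_Integration.integrable_bound[OF assms(3)] simp: cmod_power2)
  have intRe: "integrable M (\<lambda>\<omega>. Re (Z \<omega>) * d j \<omega>)"
    by (rule integrable_mult_square[OF measurable_G[OF _ Re(1)] d_measurable Re(2) square_integrable])
       (use \<open>j < n\<close> in auto)
  have intIm: "integrable M (\<lambda>\<omega>. Im (Z \<omega>) * d j \<omega>)"
    by (rule integrable_mult_square[OF measurable_G[OF _ Im(1)] d_measurable Im(2) square_integrable])
       (use \<open>j < n\<close> in auto)
  have eq: "Z \<omega> * of_real (d j \<omega>) = of_real (Re (Z \<omega>) * d j \<omega>) + \<i> * of_real (Im (Z \<omega>) * d j \<omega>)" for \<omega>
    by (simp add: complex_eq_iff)
  show "integrable M (\<lambda>\<omega>. Z \<omega> * of_real (d j \<omega>))"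
    unfolding eq using intRe intIm
    by (intro Bochner_Integration.integrable_add integrable_mult_right integrable_of_real) auto
  have "(\<integral>\<omega>. Z \<omega> * of_real (d j \<omega>) \<partial>M) =
    of_real (\<integral>\<omega>. Re (Z \<omega>) * d j \<omega> \<partial>M) + \<i> * of_real (\<integral>\<omega>. Im (Z \<omega>) * d j \<omega> \<partial>M)"
    unfolding eq using intRe intIm
    by (subst Bochner_Integration.integral_add)
       (simp_all only: integrable_mult_right integrable_of_real integral_mult_right_zero integral_complex_of_real)
  then show "(\<integral>\<omega>. Z \<omega> * of_real (d j \<omega>) \<partial>M) = 0"
    using orthogonal[OF \<open>j < n\<close>] Re Im by simp
qed

lemma integrable_bounded_mult_square:
  assumes "j < n" "b \<in> borel_measurable (G j)" "\<And>\<omega>. \<omega> \<in> space M \<Longrightarrow> \<bar>b \<omega>\<bar> \<le> c"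
  shows "integrable M (\<lambda>\<omega>. (b \<omega> * d j \<omega>)\<^sup>2)"
    and "(\<integral>\<omega>. (b \<omega> * d j \<omega>)\<^sup>2 \<partial>M) \<le> c\<^sup>2 * (\<integral>\<omega>. (d j \<omega>)\<^sup>2 \<partial>M)"
proof -
  have le: "(b \<omega> * d j \<omega>)\<^sup>2 \<le> c\<^sup>2 * (d j \<omega>)\<^sup>2" if "\<omega> \<in> space M" for \<omega>
    unfolding power_mult_distrib using assms(3)[OF that]
    by (intro mult_right_mono) (auto simp: abs_le_square_iff[symmetric])
  have int: "integrable M (\<lambda>\<omega>. c\<^sup>2 * (d j \<omega>)\<^sup>2)"
    using square_integrable assms by auto
  show *: "integrable M (\<lambda>\<omega>. (b \<omega> * d j \<omega>)\<^sup>2)"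
    using measurable_G[OF _ assms(2)] d_measurable[OF \<open>j < n\<close>] \<open>j < n\<close>
    by (intro Bochner_Integration.integrable_bound[OF int]) (auto intro!: AE_I2 simp: le)
  show "(\<integral>\<omega>. (b \<omega> * d j \<omega>)\<^sup>2 \<partial>M) \<le> c\<^sup>2 * (\<integral>\<omega>. (d j \<omega>)\<^sup>2 \<partial>M)"
    using integral_mono[OF * int le] by simp
qed

text \<open>Pythagoras for martingale increments: in the induction step the cross term is the
  integral of \<open>P\<close> times \<open>b m\<close> times \<open>d m\<close>, and
  \<open>P\<close> times \<open>b m\<close> is known at time \<open>m\<close>, so orthogonality
  kills it. The bound on the coefficients supplies the square integrability this needs.\<close>

lemma transform_second_moment:
  assumes b: "\<And>j. j < n \<Longrightarrow> b j \<in> borel_measurable (G j)"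
    and c: "\<And>j \<omega>. j < n \<Longrightarrow> \<omega> \<in> space M \<Longrightarrow> \<bar>b j \<omega>\<bar> \<le> c"
    and "m \<le> n"
  shows "integrable M (\<lambda>\<omega>. (\<Sum>j<m. b j \<omega> * d j \<omega>)\<^sup>2)"
    and "(\<integral>\<omega>. (\<Sum>j<m. b j \<omega> * d j \<omega>)\<^sup>2 \<partial>M) = (\<Sum>j<m. \<integral>\<omega>. (b j \<omega> * d j \<omega>)\<^sup>2 \<partial>M)"
proof -
  have "integrable M (\<lambda>\<omega>. (\<Sum>j<m. b j \<omega> * d j \<omega>)\<^sup>2) \<and>
    (\<integral>\<omega>. (\<Sum>j<m. b j \<omega> * d j \<omega>)\<^sup>2 \<partial>M) = (\<Sum>j<m. \<integral>\<omega>. (b j \<omega> * d j \<omega>)\<^sup>2 \<partial>M)"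
    using \<open>m \<le> n\<close>
  proof (induction m)
    case (Suc m)
    define P where "P \<omega> = (\<Sum>j<m. b j \<omega> * d j \<omega>)" for \<omega>
    have m: "m < n" and IH: "integrable M (\<lambda>\<omega>. (P \<omega>)\<^sup>2)"
        "(\<integral>\<omega>. (P \<omega>)\<^sup>2 \<partial>M) = (\<Sum>j<m. \<integral>\<omega>. (b j \<omega> * d j \<omega>)\<^sup>2 \<partial>M)"
      using Suc by (auto simp: P_def)
    have bm: "b j \<in> borel_measurable (G m)" if "j \<le> m" for j
      using that m b[of j] measurable_G_mono[of j m] by auto
    have dm: "d j \<in> borel_measurable (G m)" if "j < m" for j
      using that m d_measurable_G by auto
    have P_meas: "P \<in> borel_measurable (G m)"
      unfolding P_def using bm dm by (intro borel_measurable_sum borel_measurable_times) auto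
    have bdM: "(\<lambda>\<omega>. b m \<omega> * d m \<omega>) \<in> borel_measurable M" "P \<in> borel_measurable M" "b m \<in> borel_measurable M"
      using measurable_G[OF _ bm[of m]] d_measurable[OF m] measurable_G[OF _ P_meas] m by auto
    note bd = integrable_bounded_mult_square[OF m bm[OF order_refl] c[OF m]]
    have Pb_meas: "(\<lambda>\<omega>. P \<omega> * b m \<omega>) \<in> borel_measurable (G m)"
      using P_meas bm[of m] by simp
    have "integrable M (\<lambda>\<omega>. (P \<omega> * b m \<omega>)\<^sup>2)"
    proof (rule Bochner_Integration.integrable_bound)
      show "integrable M (\<lambda>\<omega>. c\<^sup>2 * (P \<omega>)\<^sup>2)" using IH by simp
      have "(P \<omega> * b m \<omega>)\<^sup>2 \<le> c\<^sup>2 * (P \<omega>)\<^sup>2" if "\<omega> \<in> space M" for \<omega>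
        unfolding power_mult_distrib mult.commute[of "(P \<omega>)\<^sup>2"] using c[OF m that]
        by (intro mult_right_mono) (auto simp: abs_le_square_iff[symmetric])
      then show "AE \<omega> in M. norm ((P \<omega> * b m \<omega>)\<^sup>2) \<le> norm (c\<^sup>2 * (P \<omega>)\<^sup>2)" by (intro AE_I2) simp
    qed (use bdM in simp)
    from orthogonal[OF m Pb_meas this]
    have 0: "(\<integral>\<omega>. P \<omega> * (b m \<omega> * d m \<omega>) \<partial>M) = 0" by (simp add: mult.assoc)
    have int: "integrable M (\<lambda>\<omega>. P \<omega> * (b m \<omega> * d m \<omega>))"
      by (rule integrable_mult_square[OF bdM(2,1) IH(1) bd(1)])
    have eq: "(\<Sum>j<Suc m. b j \<omega> * d j \<omega>)\<^sup>2
      = (P \<omega>)\<^sup>2 + (b m \<omega> * d m \<omega>)\<^sup>2 + 2 * (P \<omega> * (b m \<omega> * d m \<omega>))" for \<omega>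
      by (simp add: P_def power2_sum)
    show ?case unfolding eq using IH bd int 0 by simp
  qed simp
  then show "integrable M (\<lambda>\<omega>. (\<Sum>j<m. b j \<omega> * d j \<omega>)\<^sup>2)"
    and "(\<integral>\<omega>. (\<Sum>j<m. b j \<omega> * d j \<omega>)\<^sup>2 \<partial>M) = (\<Sum>j<m. \<integral>\<omega>. (b j \<omega> * d j \<omega>)\<^sup>2 \<partial>M)" by auto
qed

text \<open>Shows that a transform with small predictable coefficients is small in L2; this is what
  disposes of the truncated mixed sum of remainders and increments.\<close>

lemma transform_second_moment_le:
  assumes b: "\<And>j. j < n \<Longrightarrow> b j \<in> borel_measurable (G j)"
    and c: "\<And>j \<omega>. j < n \<Longrightarrow> \<omega> \<in> space M \<Longrightarrow> \<bar>b j \<omega>\<bar> \<le> c"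
  shows "(\<integral>\<omega>. (\<Sum>j<n. b j \<omega> * d j \<omega>)\<^sup>2 \<partial>M) \<le> c\<^sup>2 * (\<Sum>j<n. \<integral>\<omega>. (d j \<omega>)\<^sup>2 \<partial>M)"
proof -
  have "(\<integral>\<omega>. (\<Sum>j<n. b j \<omega> * d j \<omega>)\<^sup>2 \<partial>M) = (\<Sum>j<n. \<integral>\<omega>. (b j \<omega> * d j \<omega>)\<^sup>2 \<partial>M)"
    by (rule transform_second_moment(2)) (auto intro: b c)
  also have "\<dots> \<le> (\<Sum>j<n. c\<^sup>2 * (\<integral>\<omega>. (d j \<omega>)\<^sup>2 \<partial>M))"
    by (intro sum_mono integrable_bounded_mult_square(2)) (auto intro: b c)
  finally show ?thesis by (simp add: sum_distrib_left)
qed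

lemma second_moment_sum:
  "(\<integral>\<omega>. (\<Sum>j<n. d j \<omega>)\<^sup>2 \<partial>M) = (\<Sum>j<n. \<integral>\<omega>. (d j \<omega>)\<^sup>2 \<partial>M)"
  using transform_second_moment(2)[of "\<lambda>_ _. 1" 1 n] by simp

section \<open>Quadratic variation and McLeish's stopped product\<close>

text \<open>The sum stops before index \<open>m\<close>, so \<open>qv m\<close> is known at time
  \<open>m\<close> and an indicator of \<open>qv m\<close> multiplying the next increment
  \<open>d m\<close> is predictable.\<close>

definition qv :: "nat \<Rightarrow> 'a \<Rightarrow> real" where
  "qv m \<omega> = (\<Sum>j<m. (d j \<omega>)\<^sup>2)"

text \<open>McLeish's product, stopped once the quadratic variation exceeds 2; without the stopping it
  need not be square integrable.\<close>

definition mcleish :: "real \<Rightarrow> nat \<Rightarrow> 'a \<Rightarrow> complex" where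
  "mcleish t m \<omega> = (\<Prod>j<m. 1 + \<i> * of_real (t * (d j \<omega> * of_bool (qv j \<omega> \<le> 2))))"

lemma qv_mono: "i \<le> j \<Longrightarrow> qv i \<omega> \<le> qv j \<omega>"
  unfolding qv_def by (intro sum_mono2) auto

lemma qv_nonneg: "0 \<le> qv m \<omega>"
  unfolding qv_def by (intro sum_nonneg) auto

lemma qv_measurable_G: "m \<le> n \<Longrightarrow> qv m \<in> borel_measurable (G m)"
  unfolding qv_def using d_measurable_G by auto

lemma mcleish_measurable_G:
  assumes "m \<le> n"
  shows "mcleish t m \<in> borel_measurable (G m)"
  unfolding mcleish_def
proof (intro borel_measurable_prod)
  fix j assume "j \<in> {..<m}"
  then have [measurable]: "qv j \<in> borel_measurable (G m)" "d j \<in> borel_measurable (G m)"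
    using assms qv_measurable_G[of j] measurable_G_mono[of j m] d_measurable_G by auto
  show "(\<lambda>\<omega>. 1 + \<i> * of_real (t * (d j \<omega> * of_bool (qv j \<omega> \<le> 2)))) \<in> borel_measurable (G m)"
    by measurable
qed

text \<open>As long as the quadratic variation is at most 2, the squared factors 1 + t^2 d^2 are
  bounded by exponentials whose product is at most exp(2 t^2). The increment that crosses the level
  still enters, contributing at most 1 + t^2 \<open>qv m \<omega>\<close>; all later factors are 1.
  The bound is integrable because \<open>qv\<close> is.\<close>

lemma norm_mcleish_le:
  "(cmod (mcleish t m \<omega>))\<^sup>2 \<le> exp (2 * t\<^sup>2) * (1 + t\<^sup>2 * qv m \<omega>)"
proof -
  have step: "(cmod (mcleish t (Suc m) \<omega>))\<^sup>2 =
      (cmod (mcleish t m \<omega>))\<^sup>2 * (1 + t\<^sup>2 * (d m \<omega>)\<^sup>2 * of_bool (qv m \<omega> \<le> 2))" for m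
    by (auto simp: mcleish_def norm_mult power_mult_distrib cmod_power2)
  have exp_le: "exp (t\<^sup>2 * qv m \<omega>) \<le> exp (2 * t\<^sup>2)" if "qv m \<omega> \<le> 2" for m
    using mult_left_mono[OF that, of "t\<^sup>2"] by (simp add: mult.commute)
  \<comment> \<open>The induction needs the sharper exponential bound before the crossing, since it
    must leave room for the next factor.\<close>
  have "(cmod (mcleish t m \<omega>))\<^sup>2 \<le>
     (if qv m \<omega> \<le> 2 then exp (t\<^sup>2 * qv m \<omega>) else exp (2 * t\<^sup>2) * (1 + t\<^sup>2 * qv m \<omega>))"
  proof (induction m)
    case 0
    then show ?case by (simp add: mcleish_def qv_def)
  next
    case (Suc m)
    have qv_Suc: "qv (Suc m) \<omega> = qv m \<omega> + (d m \<omega>)\<^sup>2" by (simp add: qv_def)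
    show ?case
    proof (cases "qv m \<omega> \<le> 2")
      case False
      then have "\<not> qv (Suc m) \<omega> \<le> 2" "qv m \<omega> \<le> qv (Suc m) \<omega>" using qv_mono[of m "Suc m" \<omega>] by auto
      moreover from this have "exp (2 * t\<^sup>2) * (1 + t\<^sup>2 * qv m \<omega>) \<le> exp (2 * t\<^sup>2) * (1 + t\<^sup>2 * qv (Suc m) \<omega>)"
        by (intro mult_left_mono add_mono) auto
      ultimately show ?thesis using order_trans[OF Suc] False by (simp add: step)
    next
      case True
      then have le: "(cmod (mcleish t (Suc m) \<omega>))\<^sup>2 \<le> exp (t\<^sup>2 * qv m \<omega>) * (1 + t\<^sup>2 * (d m \<omega>)\<^sup>2)"
        unfolding step using Suc by (intro mult_mono) auto
      show ?thesis
      proof (cases "qv (Suc m) \<omega> \<le> 2")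
        case True
        have "exp (t\<^sup>2 * qv m \<omega>) * (1 + t\<^sup>2 * (d m \<omega>)\<^sup>2) \<le> exp (t\<^sup>2 * qv m \<omega>) * exp (t\<^sup>2 * (d m \<omega>)\<^sup>2)"
          by (intro mult_left_mono exp_ge_add_one_self) auto
        also have "\<dots> = exp (t\<^sup>2 * qv (Suc m) \<omega>)"
          by (simp add: qv_Suc distrib_left exp_add)
        finally show ?thesis using le True by simp
      next
        case False
        \<comment> \<open>The crossing step: the past contributes at most exp(2 t^2), and the square
          of the crossing increment is at most the new quadratic variation.\<close>
        have "exp (t\<^sup>2 * qv m \<omega>) * (1 + t\<^sup>2 * (d m \<omega>)\<^sup>2) \<le> exp (2 * t\<^sup>2) * (1 + t\<^sup>2 * qv (Suc m) \<omega>)"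
          using qv_nonneg[of m \<omega>] exp_le[OF True] by (intro mult_mono add_mono mult_left_mono) (auto simp: qv_Suc)
        then show ?thesis using le False by simp
      qed
    qed
  qed
  also have "\<dots> \<le> exp (2 * t\<^sup>2) * (1 + t\<^sup>2 * qv m \<omega>)"
  proof -
    have "exp (2 * t\<^sup>2) * 1 \<le> exp (2 * t\<^sup>2) * (1 + t\<^sup>2 * qv m \<omega>)"
      using qv_nonneg[of m \<omega>] by (intro mult_left_mono) auto
    then show ?thesis using order_trans[OF exp_le[of m]] by auto
  qed
  finally show ?thesis .
qed

lemma integrable_qv:
  assumes "m \<le> n"
  shows "integrable M (qv m)"
  unfolding qv_def using assms square_integrable by (intro Bochner_Integration.integrable_sum) auto

lemma integrable_norm_mcleish_square:
  assumes "m \<le> n"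
  shows "integrable M (\<lambda>\<omega>. (cmod (mcleish t m \<omega>))\<^sup>2)"
proof (rule Bochner_Integration.integrable_bound)
  show "integrable M (\<lambda>\<omega>. exp (2 * t\<^sup>2) * (1 + t\<^sup>2 * qv m \<omega>))"
    using integrable_qv[OF assms] by simp
  show "(\<lambda>\<omega>. (cmod (mcleish t m \<omega>))\<^sup>2) \<in> borel_measurable M"
    using measurable_G[OF assms mcleish_measurable_G[OF assms]] by measurable
  show "AE \<omega> in M. norm ((cmod (mcleish t m \<omega>))\<^sup>2) \<le> norm (exp (2 * t\<^sup>2) * (1 + t\<^sup>2 * qv m \<omega>))"
    using order_trans[OF norm_mcleish_le abs_ge_self] by (intro AE_I2) auto
qed

text \<open>Multiplying out the last factor adds a constant times \<open>Z\<close> times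
  \<open>d m\<close> with \<open>Z\<close> known at time \<open>m\<close>. This has mean zero, so
  the expectation keeps its initial value 1.\<close>

lemma integral_mcleish:
  assumes "m \<le> n"
  shows "integrable M (mcleish t m)" and "(\<integral>\<omega>. mcleish t m \<omega> \<partial>M) = 1"
proof -
  have "integrable M (mcleish t m) \<and> (\<integral>\<omega>. mcleish t m \<omega> \<partial>M) = 1"
    using assms
  proof (induction m)
    case 0
    then show ?case by (simp add: mcleish_def[abs_def] prob_space)
  next
    case (Suc m)
    then have m: "m < n" "m \<le> n" by auto
    define Z where "Z \<omega> = mcleish t m \<omega> * of_bool (qv m \<omega> \<le> 2)" for \<omega>
    have [measurable]: "mcleish t m \<in> borel_measurable (G m)" "qv m \<in> borel_measurable (G m)"
      using mcleish_measurable_G qv_measurable_G m by auto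
    have Z: "Z \<in> borel_measurable (G m)"
      unfolding Z_def by measurable
    have "integrable M (\<lambda>\<omega>. (cmod (Z \<omega>))\<^sup>2)"
      using borel_measurable_power[OF measurable_compose[OF measurable_G[OF m(2) Z] borel_measurable_norm], of 2]
      by (intro Bochner_Integration.integrable_bound[OF integrable_norm_mcleish_square[OF m(2), of t]])
         (auto simp: Z_def norm_mult of_bool_def)
    note Zd = complex_orthogonal[OF m(1) Z this]
    have eq: "mcleish t (Suc m) = (\<lambda>\<omega>. mcleish t m \<omega> + (\<i> * of_real t) * (Z \<omega> * of_real (d m \<omega>)))"
      by (auto simp: mcleish_def Z_def algebra_simps)
    show ?case
      unfolding eq using Suc Zd
      by (auto simp: Bochner_Integration.integral_add[OF _ integrable_mult_right])
  qed
  then show "integrable M (mcleish t m)" and "(\<integral>\<omega>. mcleish t m \<omega> \<partial>M) = 1" by auto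
qed

section \<open>Distance of the characteristic function of one row from the Gaussian one\<close>

text \<open>Since the stopped product has mean 1, the left side is the modulus of the mean of
  \<open>W\<close>. Off the exceptional event \<open>B\<close> the deterministic estimate applies.
  On \<open>B\<close> only a second moment bound is available, and \<eta> balances it against the
  probability of \<open>B\<close>: \<eta> can be fixed small before that probability is sent to
  0.\<close>

lemma char_sum_minus_gauss_le:
  assumes unit: "(\<Sum>j<n. \<integral>\<omega>. (d j \<omega>)\<^sup>2 \<partial>M) = 1"
    and \<delta>: "\<bar>t\<bar> * \<delta> \<le> 1" "0 \<le> \<delta>" "\<delta> \<le> 1" and "0 < \<eta>" and B: "B \<in> events"
    and small: "\<And>j \<omega>. j < n \<Longrightarrow> \<omega> \<in> space M - B \<Longrightarrow> \<bar>d j \<omega>\<bar> \<le> \<delta>"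
    and qv: "\<And>\<omega>. \<omega> \<in> space M - B \<Longrightarrow> \<bar>qv n \<omega> - 1\<bar> \<le> \<delta>"
  shows "cmod ((\<integral>\<omega>. iexp (t * (\<Sum>j<n. d j \<omega>)) \<partial>M) - of_real (exp (- (t\<^sup>2) / 2)))
     \<le> 4 * \<bar>t\<bar> ^ 3 * \<delta> + (exp (t\<^sup>2 * \<delta> / 2) - 1) + \<eta> * (2 + 2 * exp (2 * t\<^sup>2) * (1 + t\<^sup>2)) + prob B / \<eta>"
proof -
  define \<epsilon> where "\<epsilon> = 4 * \<bar>t\<bar> ^ 3 * \<delta> + (exp (t\<^sup>2 * \<delta> / 2) - 1)"
  define e where "e = exp (- (t\<^sup>2) / 2)"
  define W where "W \<omega> = iexp (t * (\<Sum>j<n. d j \<omega>)) - of_real e * mcleish t n \<omega>" for \<omega>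
  \<comment> \<open>A pointwise majorant of the modulus of \<open>W\<close>, whose integral is
    exactly the claimed bound because \<open>qv n\<close> has mean 1.\<close>
  define K where "K \<omega> = \<epsilon> + \<eta> * (2 + 2 * exp (2 * t\<^sup>2) * (1 + t\<^sup>2 * qv n \<omega>)) + indicator B \<omega> / \<eta>" for \<omega>
  have "0 \<le> \<epsilon>" using \<delta> by (simp add: \<epsilon>_def)
  have "0 < e" "e \<le> 1" by (auto simp: e_def)
  have meas: "(\<lambda>\<omega>. iexp (t * (\<Sum>j<n. d j \<omega>))) \<in> borel_measurable M"
  proof -
    have [measurable]: "(\<lambda>\<omega>. \<Sum>j<n. d j \<omega>) \<in> borel_measurable M"
      using d_measurable by (intro borel_measurable_sum) auto
    show ?thesis by measurable
  qed
  have int1: "integrable M (\<lambda>\<omega>. iexp (t * (\<Sum>j<n. d j \<omega>)))"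
    by (rule integrable_const_bound[where B = 1]) (use meas in auto)
  have intW: "integrable M W"
    unfolding W_def using int1 integral_mcleish(1)[OF order_refl, of t] by auto
  have "(\<integral>\<omega>. W \<omega> \<partial>M) = (\<integral>\<omega>. iexp (t * (\<Sum>j<n. d j \<omega>)) \<partial>M) - of_real e"
    unfolding W_def using int1 integral_mcleish[OF order_refl, of t]
    by (subst Bochner_Integration.integral_diff) auto
  then have eq: "cmod ((\<integral>\<omega>. iexp (t * (\<Sum>j<n. d j \<omega>)) \<partial>M) - of_real e) \<le> (\<integral>\<omega>. cmod (W \<omega>) \<partial>M)"
    using integral_norm_bound[of M W] by simp
  have W_le: "cmod (W \<omega>) \<le> K \<omega>" if \<omega>: "\<omega> \<in> space M" for \<omega>
  proof (cases "\<omega> \<in> B")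
    case False
    then have "\<omega> \<in> space M - B" using \<omega> by simp
    note qv = qv[OF this] and small = small[OF _ this]
    \<comment> \<open>Off \<open>B\<close> the quadratic variation never exceeds 1 + \<delta> \<le>
      2, so the stopping is inactive and the full product appears.\<close>
    have "qv j \<omega> \<le> 2" if "j < n" for j
      using qv_mono[of j n \<omega>] that qv \<delta> by auto
    then have "mcleish t n \<omega> = (\<Prod>j<n. 1 + \<i> * of_real (t * d j \<omega>))"
      by (auto simp: mcleish_def intro!: prod.cong)
    then have "cmod (W \<omega>) \<le> \<epsilon>"
      unfolding W_def e_def \<epsilon>_def
      using norm_iexp_sum_minus_prod_le[of "{..<n}" "\<lambda>j. d j \<omega>" \<delta> t] small qv \<delta> by (simp add: qv_def)
    then show ?thesis using \<open>0 < \<eta>\<close> qv_nonneg[of n \<omega>] by (simp add: K_def add_increasing2)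
  next
    case True
    have "cmod (W \<omega>) \<le> 1 + e * cmod (mcleish t n \<omega>)"
      unfolding W_def using \<open>0 < e\<close> by (intro order_trans[OF norm_triangle_ineq4]) (simp add: norm_mult)
    also have "\<dots> \<le> 1 + cmod (mcleish t n \<omega>)"
      using \<open>e \<le> 1\<close> \<open>0 < e\<close> by (simp add: mult_left_le_one_le)
    finally have "(cmod (W \<omega>))\<^sup>2 \<le> (1 + cmod (mcleish t n \<omega>))\<^sup>2" by (intro power_mono) auto
    also have "\<dots> \<le> 2 + 2 * (cmod (mcleish t n \<omega>))\<^sup>2"
      using sum_squares_bound[of 1 "cmod (mcleish t n \<omega>)"] by (simp add: power2_sum)
    also have "\<dots> \<le> 2 + 2 * exp (2 * t\<^sup>2) * (1 + t\<^sup>2 * qv n \<omega>)"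
      using norm_mcleish_le[of t n \<omega>] by simp
    finally have W2: "\<eta> * (cmod (W \<omega>))\<^sup>2 \<le> \<eta> * (2 + 2 * exp (2 * t\<^sup>2) * (1 + t\<^sup>2 * qv n \<omega>))"
      using \<open>0 < \<eta>\<close> by (intro mult_left_mono) auto
    \<comment> \<open>Split at 1/\<eta>: below it the second summand suffices; above it \<eta> times
      the modulus is at least 1, and the first one does.\<close>
    have "cmod (W \<omega>) \<le> \<eta> * (cmod (W \<omega>))\<^sup>2 + 1 / \<eta>"
    proof (cases "cmod (W \<omega>) \<le> 1 / \<eta>")
      case True
      then show ?thesis using \<open>0 < \<eta>\<close> by (simp add: add_increasing)
    next
      case False
      then have "1 \<le> \<eta> * cmod (W \<omega>)" using \<open>0 < \<eta>\<close> by (simp add: field_simps)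
      then have "1 * cmod (W \<omega>) \<le> \<eta> * cmod (W \<omega>) * cmod (W \<omega>)"
        by (intro mult_right_mono) auto
      then show ?thesis using \<open>0 < \<eta>\<close> by (simp add: power2_eq_square mult.assoc add_increasing2)
    qed
    also have "\<dots> \<le> K \<omega>"
      using W2 \<open>0 \<le> \<epsilon>\<close> True by (simp add: K_def)
    finally show ?thesis .
  qed
  have ind: "integrable M (indicator B :: 'a \<Rightarrow> real)"
    using B by (intro integrable_real_indicator) (simp_all add: less_top[symmetric])
  have EQ: "(\<integral>\<omega>. qv n \<omega> \<partial>M) = 1"
    unfolding qv_def using square_integrable unit by (subst Bochner_Integration.integral_sum) auto
  have K: "integrable M K" "(\<integral>\<omega>. K \<omega> \<partial>M) = \<epsilon> + \<eta> * (2 + 2 * exp (2 * t\<^sup>2) * (1 + t\<^sup>2)) + prob B / \<eta>"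
    unfolding K_def using integrable_qv[OF order_refl] ind B EQ by (auto simp: prob_space)
  show ?thesis
    using order_trans[OF eq integral_mono[OF integrable_norm[OF intW] K(1) W_le]]
    unfolding K(2) e_def \<epsilon>_def by simp
qed

end

section \<open>Central limit theorem for martingale difference arrays\<close>

text \<open>By Levy's continuity theorem the bound for single rows suffices, with \<open>B\<close>
  the event that some increment or the deviation of the sum of squares from 1 exceeds \<delta>.
  \<open>S\<close> is kept apart from the sum of the increments because in the application the two
  agree only almost everywhere.\<close>

lemma (in prob_space) martingale_central_limit_theorem:
  fixes d :: "nat \<Rightarrow> nat \<Rightarrow> 'a \<Rightarrow> real"
  assumes row: "\<And>n. 1 \<le> n \<Longrightarrow> mds_row M (G n) (d n) n"
    and S_meas: "\<And>n. S n \<in> borel_measurable M"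
    and S: "\<And>n. 1 \<le> n \<Longrightarrow> AE \<omega> in M. S n \<omega> = (\<Sum>j<n. d n j \<omega>)"
    and variance_1: "\<And>n. 1 \<le> n \<Longrightarrow> (\<integral>\<omega>. (S n \<omega>)\<^sup>2 \<partial>M) = 1"
    and max_small: "\<And>\<delta>. 0 < \<delta> \<Longrightarrow> (\<lambda>n. prob {\<omega>\<in>space M. \<exists>j<n. \<bar>d n j \<omega>\<bar> > \<delta>}) \<longlonglongrightarrow> 0"
    and squares: "tendsto_in_prob M (\<lambda>n \<omega>. \<Sum>j<n. (d n j \<omega>)\<^sup>2) (\<lambda>_. 1)"
  shows "weak_conv_m (\<lambda>n. distr M borel (S n)) std_normal_distribution"
proof (rule levy_continuity)
  show "real_distribution (distr M borel (S n))" for n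
    by (rule real_distribution_distr) (rule S_meas)
  show "real_distribution std_normal_distribution" by (rule real_dist_normal_dist)
  fix t :: real
  define C where "C = 2 + 2 * exp (2 * t\<^sup>2) * (1 + t\<^sup>2)"
  have "0 < C" by (auto simp: C_def intro!: add_pos_nonneg)
  define B where "B \<delta> n = {\<omega>\<in>space M. \<exists>j<n. \<bar>d n j \<omega>\<bar> > \<delta>} \<union>
      {\<omega>\<in>space M. \<bar>(\<Sum>j<n. (d n j \<omega>)\<^sup>2) - 1\<bar> > \<delta>}" for \<delta> n
  have d_meas: "d n j \<in> borel_measurable M" if "j < n" for n j
    using mds_row.d_measurable[OF row[of n], of j] that by simp
  have B_meas: "{\<omega>\<in>space M. \<exists>j<n. \<bar>d n j \<omega>\<bar> > \<delta>} \<in> events"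
      "{\<omega>\<in>space M. \<bar>(\<Sum>j<n. (d n j \<omega>)\<^sup>2) - 1\<bar> > \<delta>} \<in> events" for \<delta> n
  proof -
    have "{\<omega>\<in>space M. \<bar>d n j \<omega>\<bar> > \<delta>} \<in> events" if "j < n" for j
      using d_meas[OF that] by measurable
    then have "(\<Union>j<n. {\<omega>\<in>space M. \<bar>d n j \<omega>\<bar> > \<delta>}) \<in> events" by auto
    moreover have "(\<Union>j<n. {\<omega>\<in>space M. \<bar>d n j \<omega>\<bar> > \<delta>}) = {\<omega>\<in>space M. \<exists>j<n. \<bar>d n j \<omega>\<bar> > \<delta>}" by auto
    ultimately show "{\<omega>\<in>space M. \<exists>j<n. \<bar>d n j \<omega>\<bar> > \<delta>} \<in> events" by (simp only:)
    have "(\<lambda>\<omega>. \<Sum>j<n. (d n j \<omega>)\<^sup>2) \<in> borel_measurable M"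
      using d_meas by auto
    then show "{\<omega>\<in>space M. \<bar>(\<Sum>j<n. (d n j \<omega>)\<^sup>2) - 1\<bar> > \<delta>} \<in> events" by measurable
  qed
  have B_lim: "(\<lambda>n. prob (B \<delta> n)) \<longlonglongrightarrow> 0" if "0 < \<delta>" for \<delta>
  proof (rule tendsto_sandwich[OF _ _ tendsto_const])
    show "(\<lambda>n. prob {\<omega>\<in>space M. \<exists>j<n. \<bar>d n j \<omega>\<bar> > \<delta>} +
      prob {\<omega>\<in>space M. \<bar>(\<Sum>j<n. (d n j \<omega>)\<^sup>2) - 1\<bar> > \<delta>}) \<longlonglongrightarrow> 0"
      using tendsto_add[OF max_small[OF that] squares[unfolded tendsto_in_prob_def, rule_format, OF that]] by simp
    show "\<forall>\<^sub>F n in sequentially. prob (B \<delta> n) \<le> prob {\<omega>\<in>space M. \<exists>j<n. \<bar>d n j \<omega>\<bar> > \<delta>} +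
      prob {\<omega>\<in>space M. \<bar>(\<Sum>j<n. (d n j \<omega>)\<^sup>2) - 1\<bar> > \<delta>}"
      unfolding B_def by (intro always_eventually allI measure_Un_le B_meas)
  qed simp
  have bound: "cmod (char (distr M borel (S n)) t - of_real (exp (- (t\<^sup>2) / 2)))
      \<le> 4 * \<bar>t\<bar> ^ 3 * \<delta> + (exp (t\<^sup>2 * \<delta> / 2) - 1) + \<eta> * C + prob (B \<delta> n) / \<eta>"
    if "1 \<le> n" "\<bar>t\<bar> * \<delta> \<le> 1" "0 \<le> \<delta>" "\<delta> \<le> 1" "0 < \<eta>" for n \<delta> \<eta>
  proof -
    interpret mds_row M "G n" "d n" n by (rule row) fact
    have [measurable]: "(\<lambda>\<omega>. \<Sum>j<n. d n j \<omega>) \<in> borel_measurable M" "S n \<in> borel_measurable M"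
      using d_measurable S_meas by (auto intro!: borel_measurable_sum)
    have "char (distr M borel (S n)) t = (\<integral>\<omega>. iexp (t * S n \<omega>) \<partial>M)"
      unfolding char_def using S_meas[of n] by (subst integral_distr) auto
    also have "\<dots> = (\<integral>\<omega>. iexp (t * (\<Sum>j<n. d n j \<omega>)) \<partial>M)"
    proof (rule integral_cong_AE)
      show "AE \<omega> in M. iexp (t * S n \<omega>) = iexp (t * (\<Sum>j<n. d n j \<omega>))"
        using S[OF \<open>1 \<le> n\<close>] by eventually_elim simp
    qed measurable
    finally have char_eq: "char (distr M borel (S n)) t = \<dots>" .
    have "(\<Sum>j<n. \<integral>\<omega>. (d n j \<omega>)\<^sup>2 \<partial>M) = (\<integral>\<omega>. (S n \<omega>)\<^sup>2 \<partial>M)"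
      unfolding second_moment_sum[symmetric]
    proof (rule integral_cong_AE)
      show "AE \<omega> in M. (\<Sum>j<n. d n j \<omega>)\<^sup>2 = (S n \<omega>)\<^sup>2"
        using S[OF \<open>1 \<le> n\<close>] by eventually_elim simp
    qed measurable
    then have unit: "(\<Sum>j<n. \<integral>\<omega>. (d n j \<omega>)\<^sup>2 \<partial>M) = 1" using variance_1[OF \<open>1 \<le> n\<close>] by simp
    have B_event: "B \<delta> n \<in> events" unfolding B_def by (intro sets.Un B_meas)
    show ?thesis
      unfolding char_eq C_def
    proof (rule char_sum_minus_gauss_le[OF unit that(2-5) B_event])
      fix \<omega> assume "\<omega> \<in> space M - B \<delta> n"
      then have *: "\<forall>j<n. \<not> \<delta> < \<bar>d n j \<omega>\<bar>" "\<not> \<delta> < \<bar>(\<Sum>j<n. (d n j \<omega>)\<^sup>2) - 1\<bar>"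
        unfolding B_def by blast+
      then show "\<bar>qv n \<omega> - 1\<bar> \<le> \<delta>" by (simp only: qv_def not_less)
      show "\<bar>d n j \<omega>\<bar> \<le> \<delta>" if "j < n" for j
        using *(1) that by (simp only: not_less)
    qed
  qed
  have "(\<lambda>n. char (distr M borel (S n)) t) \<longlonglongrightarrow> of_real (exp (- (t\<^sup>2) / 2))"
  proof (rule tendstoI)
    fix e :: real assume "0 < e"
    \<comment> \<open>The error \<open>e\<close> is split into thirds: first \<delta> makes the
      deterministic part small, then \<eta> the second moment part, and finally large
      \<open>n\<close> the probability part.\<close>
    have "((\<lambda>\<delta>. 4 * \<bar>t\<bar> ^ 3 * \<delta> + (exp (t\<^sup>2 * \<delta> / 2) - 1)) \<longlongrightarrow> 4 * \<bar>t\<bar> ^ 3 * 0 + (exp (t\<^sup>2 * 0 / 2) - 1)) (at_right 0)"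
      by (intro tendsto_intros) auto
    then have "\<forall>\<^sub>F \<delta> in at_right 0. 4 * \<bar>t\<bar> ^ 3 * \<delta> + (exp (t\<^sup>2 * \<delta> / 2) - 1) < e / 3"
      using \<open>0 < e\<close> by (intro order_tendstoD(2)) auto
    moreover have "((\<lambda>\<delta>. \<bar>t\<bar> * \<delta>) \<longlongrightarrow> \<bar>t\<bar> * 0) (at_right 0)"
      by (intro tendsto_intros)
    then have "\<forall>\<^sub>F \<delta> in at_right 0. \<bar>t\<bar> * \<delta> < 1"
      by (intro order_tendstoD(2)) auto
    moreover have "\<forall>\<^sub>F \<delta> in at_right (0::real). 0 < \<delta> \<and> \<delta> < 1"
      using eventually_at_right_real[of 0 1] by simp
    ultimately have "\<forall>\<^sub>F \<delta> in at_right 0. 4 * \<bar>t\<bar> ^ 3 * \<delta> + (exp (t\<^sup>2 * \<delta> / 2) - 1) < e / 3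
       \<and> \<bar>t\<bar> * \<delta> < 1 \<and> 0 < \<delta> \<and> \<delta> < 1"
      by eventually_elim simp
    then obtain \<delta> where \<delta>: "4 * \<bar>t\<bar> ^ 3 * \<delta> + (exp (t\<^sup>2 * \<delta> / 2) - 1) < e / 3" "\<bar>t\<bar> * \<delta> < 1" "0 < \<delta>" "\<delta> < 1"
      using eventually_happens'[OF trivial_limit_at_right_real] by blast
    define \<eta> where "\<eta> = e / (3 * C)"
    have "0 < \<eta>" "\<eta> * C = e / 3" using \<open>0 < C\<close> \<open>0 < e\<close> by (auto simp: \<eta>_def)
    have "(\<lambda>n. prob (B \<delta> n) / \<eta>) \<longlonglongrightarrow> 0 / \<eta>"
      using \<open>0 < \<eta>\<close> \<delta> by (intro tendsto_intros B_lim) auto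
    then have "\<forall>\<^sub>F n in sequentially. prob (B \<delta> n) / \<eta> < e / 3"
      using \<open>0 < e\<close> by (intro order_tendstoD(2)) auto
    then show "\<forall>\<^sub>F n in sequentially. dist (char (distr M borel (S n)) t) (of_real (exp (- (t\<^sup>2) / 2))) < e"
      using eventually_ge_at_top[of 1]
    proof eventually_elim
      case (elim n)
      have "cmod (char (distr M borel (S n)) t - of_real (exp (- (t\<^sup>2) / 2)))
          \<le> 4 * \<bar>t\<bar> ^ 3 * \<delta> + (exp (t\<^sup>2 * \<delta> / 2) - 1) + e / 3 + prob (B \<delta> n) / \<eta>"
        using bound[of n \<delta> \<eta>] elim \<delta> \<open>0 < \<eta>\<close> \<open>\<eta> * C = e / 3\<close> by simp
      then show ?case
        unfolding dist_norm using elim(1) \<delta>(1) by linarith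
    qed
  qed
  then show "(\<lambda>n. char (distr M borel (S n)) t) \<longlonglongrightarrow> char std_normal_distribution t"
    by (simp add: char_std_normal_distribution)
qed

section \<open>The martingale attached to an adapted row\<close>

locale adapted_row = prob_space M for M :: "'a measure" +
  fixes F :: "nat \<Rightarrow> nat \<Rightarrow> 'a measure" and X :: "nat \<Rightarrow> nat \<Rightarrow> 'a \<Rightarrow> real" and n :: nat
  assumes subalgebra_F: "\<And>j. 1 \<le> j \<Longrightarrow> j \<le> n \<Longrightarrow> subalgebra M (F n j)"
    and sets_F_mono: "\<And>j. 1 \<le> j \<Longrightarrow> j < n \<Longrightarrow> sets (F n j) \<subseteq> sets (F n (Suc j))"
    and F_0: "space (F n 0) = space M" "sets (F n 0) = {{}, space M}"
    and X_measurable_F: "\<And>j. 1 \<le> j \<Longrightarrow> j \<le> n \<Longrightarrow> X n j \<in> borel_measurable (F n j)"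
    and X_square_integrable: "\<And>j. 1 \<le> j \<Longrightarrow> j \<le> n \<Longrightarrow> integrable M (\<lambda>\<omega>. (X n j \<omega>)\<^sup>2)"
    and X_centered: "\<And>j. 1 \<le> j \<Longrightarrow> j \<le> n \<Longrightarrow> (\<integral>\<omega>. X n j \<omega> \<partial>M) = 0"
begin

abbreviation A :: "nat \<Rightarrow> 'a \<Rightarrow> real" where
  "A \<equiv> cond_remainder M F X n"

text \<open>This is S_n - S_j for j \<le> n; as a tail sum it makes the recursion from
  \<open>R j\<close> to \<open>R (Suc j)\<close> and the vanishing of \<open>R n\<close>
  immediate.\<close>

definition R :: "nat \<Rightarrow> 'a \<Rightarrow> real" where
  "R j \<omega> = (\<Sum>i = Suc j..n. X n i \<omega>)"

text \<open>Indices are shifted: \<open>D j\<close> is the martingale increment from time \<open>j\<close> to time \<open>j + 1\<close>.\<close>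

definition D :: "nat \<Rightarrow> 'a \<Rightarrow> real" where
  "D j \<omega> = X n (Suc j) \<omega> + A (Suc j) \<omega> - A j \<omega>"

lemma subalgebra_F_le:
  assumes "j \<le> n"
  shows "subalgebra M (F n j)"
proof (cases "j = 0")
  case True
  then show ?thesis using F_0 by (auto simp: subalgebra_def)
qed (use assms subalgebra_F in auto)

lemma sets_F_Suc:
  assumes "j < n"
  shows "sets (F n j) \<subseteq> sets (F n (Suc j))"
proof (cases "j = 0")
  case True
  have "space (F n (Suc 0)) = space M"
    using subalgebra_F_le[of "Suc 0"] assms by (auto simp: subalgebra_def)
  then have "space M \<in> sets (F n (Suc 0))"
    using sets.top[of "F n (Suc 0)"] by simp
  then show ?thesis using True F_0 by auto
qed (use assms sets_F_mono in auto)

lemma X_measurable: "1 \<le> j \<Longrightarrow> j \<le> n \<Longrightarrow> X n j \<in> borel_measurable M"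
  using X_measurable_F subalgebra_F measurable_from_subalg by blast

lemma R_measurable: "R j \<in> borel_measurable M"
  unfolding R_def using X_measurable by (intro borel_measurable_sum) auto

lemma X_integrable: "1 \<le> j \<Longrightarrow> j \<le> n \<Longrightarrow> integrable M (X n j)"
  using square_integrable_imp_integrable[OF X_measurable X_square_integrable] by auto

lemma square_integrable_R: "integrable M (\<lambda>\<omega>. (R j \<omega>)\<^sup>2)"
proof -
  have "(\<lambda>\<omega>. \<Sum>i\<in>I. X n i \<omega>) \<in> borel_measurable M \<and> integrable M (\<lambda>\<omega>. (\<Sum>i\<in>I. X n i \<omega>)\<^sup>2)"
    if "I \<subseteq> {1..n}" for I
    using finite_subset[OF that finite_atLeastAtMost] that
  proof (induction I rule: finite_induct)
    case (insert i I)
    then show ?case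
      using X_measurable[of i] X_square_integrable[of i]
        integrable_square_add[of "X n i" M "\<lambda>\<omega>. \<Sum>i\<in>I. X n i \<omega>"] by auto
  qed simp
  from this[of "{Suc j..n}"] show ?thesis by (simp add: R_def)
qed

lemma integrable_R: "integrable M (R j)"
  using square_integrable_imp_integrable[OF R_measurable square_integrable_R] .

lemma partial_sum_diff: "j \<le> n \<Longrightarrow> partial_sum X n n \<omega> - partial_sum X n j \<omega> = R j \<omega>"
  using sum.ub_add_nat[of 1 j "\<lambda>i. X n i \<omega>" "n - j"] by (simp add: partial_sum_def R_def)

lemma A_eq: "j \<le> n \<Longrightarrow> A j = real_cond_exp M (F n j) (R j)"
  unfolding cond_remainder_def by (simp add: partial_sum_diff)

lemma A_measurable_F: "j \<le> n \<Longrightarrow> A j \<in> borel_measurable (F n j)"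
  unfolding A_eq by (rule borel_measurable_cond_exp)

lemma A_measurable: "j \<le> n \<Longrightarrow> A j \<in> borel_measurable M"
  using measurable_from_subalg[OF subalgebra_F_le A_measurable_F] .

lemma sigma_finite_subalgebra_F:
  assumes "j \<le> n"
  shows "sigma_finite_subalgebra M (F n j)"
  by (intro finite_measure_subalgebra_is_sigma_finite finite_measure_subalgebra.intro
      finite_measure_subalgebra_axioms.intro finite_measure_axioms subalgebra_F_le assms)

text \<open>Conditional Jensen inequality for the square.\<close>

lemma square_integrable_A:
  assumes "j \<le> n"
  shows "integrable M (\<lambda>\<omega>. (A j \<omega>)\<^sup>2)"
proof -
  interpret F: sigma_finite_subalgebra M "F n j" by (rule sigma_finite_subalgebra_F) fact
  show ?thesis
    unfolding A_eq[OF assms]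
    by (rule F.integrable_convex_cond_exp[where I = UNIV and q = power2])
       (use integrable_R square_integrable_R in \<open>auto simp: convex_power2\<close>)
qed

text \<open>The defining property of conditional expectation, tested against square integrable
  functions, matching the form of orthogonality in \<open>mds_row\<close>.\<close>

lemma integral_mult_A:
  assumes "j \<le> n" "Z \<in> borel_measurable (F n j)" "integrable M (\<lambda>\<omega>. (Z \<omega>)\<^sup>2)"
  shows "(\<integral>\<omega>. Z \<omega> * A j \<omega> \<partial>M) = (\<integral>\<omega>. Z \<omega> * R j \<omega> \<partial>M)"
proof -
  interpret F: sigma_finite_subalgebra M "F n j" by (rule sigma_finite_subalgebra_F) fact
  have "Z \<in> borel_measurable M" using measurable_from_subalg[OF subalgebra_F_le assms(2)] assms by simp
  then have "integrable M (\<lambda>\<omega>. Z \<omega> * R j \<omega>)"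
    using R_measurable square_integrable_R assms by (intro integrable_mult_square)
  from F.real_cond_exp_intg(2)[OF this assms(2) R_measurable]
  show ?thesis unfolding A_eq[OF assms(1)] .
qed

text \<open>Measurability for the trivial \<sigma>-field forces \<open>A 0\<close> to be constant,
  hence equal to the mean of \<open>R 0\<close>, which is 0 by centering. The equality is pointwise
  on the space.\<close>

lemma A_0:
  assumes "\<omega> \<in> space M"
  shows "A 0 \<omega> = 0"
proof -
  \<comment> \<open>The level set through \<omega> is measurable and nonempty, so it is the whole
    space.\<close>
  have "{x \<in> space (F n 0). A 0 x = A 0 \<omega>} \<in> sets (F n 0)"
    using A_measurable_F[of 0] by measurable
  then have "{x \<in> space M. A 0 x = A 0 \<omega>} = space M"
    using assms unfolding F_0 by auto
  then have const: "A 0 x = A 0 \<omega>" if "x \<in> space M" for x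
    using that by auto
  have "A 0 \<omega> = (\<integral>x. A 0 \<omega> \<partial>M)" by (simp add: prob_space)
  also have "\<dots> = (\<integral>x. 1 * A 0 x \<partial>M)"
    by (rule Bochner_Integration.integral_cong[OF refl]) (metis const mult_1)
  also have "\<dots> = (\<integral>x. 1 * R 0 x \<partial>M)"
    by (rule integral_mult_A) auto
  also have "\<dots> = 0"
    unfolding R_def using X_integrable X_centered by (simp add: Bochner_Integration.integral_sum)
  finally show ?thesis .
qed

lemma A_n: "AE \<omega> in M. A n \<omega> = 0"
proof -
  interpret F: sigma_finite_subalgebra M "F n n" by (rule sigma_finite_subalgebra_F) simp
  have "R n = (\<lambda>_. 0)" by (auto simp: R_def)
  then show ?thesis unfolding A_eq[OF order_refl]
    using F.real_cond_exp_F_meas[of "\<lambda>_. 0"] by simp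
qed

text \<open>A function \<open>Z\<close> known at time \<open>j\<close> is also known at time
  \<open>Suc j\<close>, so inside integrals against \<open>Z\<close> both remainders may be replaced
  by the tail sums \<open>R (Suc j)\<close> and \<open>R j\<close>. Then everything cancels, as
  \<open>R j\<close> is the sum of the next variable and \<open>R (Suc j)\<close>.\<close>

sublocale mds_row M "F n" D n
proof
  fix j
  show "subalgebra M (F n j)" if "j \<le> n"
    using that by (rule subalgebra_F_le)
  assume j: "j < n"
  show "sets (F n j) \<subseteq> sets (F n (Suc j))"
    using j by (rule sets_F_Suc)
  have "subalgebra (F n (Suc j)) (F n j)"
    using sets_F_Suc[OF j] subalgebra_F_le[of j] subalgebra_F_le[of "Suc j"] j
    by (auto simp: subalgebra_def)
  then have "A j \<in> borel_measurable (F n (Suc j))"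
    using A_measurable_F[of j] j measurable_from_subalg by auto
  then show "D j \<in> borel_measurable (F n (Suc j))"
    unfolding D_def using X_measurable_F[of "Suc j"] A_measurable_F[of "Suc j"] j by auto
  have XA: "integrable M (\<lambda>\<omega>. (X n (Suc j) \<omega> + A (Suc j) \<omega>)\<^sup>2)"
    using j X_measurable[of "Suc j"] A_measurable[of "Suc j"] X_square_integrable[of "Suc j"]
      square_integrable_A[of "Suc j"]
    by (intro integrable_square_add) auto
  show "integrable M (\<lambda>\<omega>. (D j \<omega>)\<^sup>2)"
    unfolding D_def
    using j X_measurable[of "Suc j"] A_measurable[of "Suc j"] A_measurable[of j] XA
      square_integrable_A[of j]
    by (intro integrable_square_diff) auto
  fix Z :: "'a \<Rightarrow> real" assume Z: "Z \<in> borel_measurable (F n j)" "integrable M (\<lambda>\<omega>. (Z \<omega>)\<^sup>2)"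
  have ZS: "Z \<in> borel_measurable (F n (Suc j))"
    using Z(1) \<open>subalgebra (F n (Suc j)) (F n j)\<close> measurable_from_subalg by blast
  have ZM: "Z \<in> borel_measurable M"
    using measurable_from_subalg[OF subalgebra_F_le Z(1)] j by simp
  note mult = integrable_mult_square[OF ZM _ Z(2)]
  have int: "integrable M (\<lambda>\<omega>. Z \<omega> * X n (Suc j) \<omega>)" "integrable M (\<lambda>\<omega>. Z \<omega> * A (Suc j) \<omega>)"
      "integrable M (\<lambda>\<omega>. Z \<omega> * A j \<omega>)" "integrable M (\<lambda>\<omega>. Z \<omega> * R (Suc j) \<omega>)"
    using j X_measurable A_measurable R_measurable X_square_integrable square_integrable_A square_integrable_R
    by (auto intro!: mult)
  have "(\<integral>\<omega>. Z \<omega> * D j \<omega> \<partial>M)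
      = (\<integral>\<omega>. Z \<omega> * X n (Suc j) \<omega> \<partial>M) + (\<integral>\<omega>. Z \<omega> * A (Suc j) \<omega> \<partial>M) - (\<integral>\<omega>. Z \<omega> * A j \<omega> \<partial>M)"
    unfolding D_def using int by (simp add: algebra_simps)
  also have "\<dots> = (\<integral>\<omega>. Z \<omega> * X n (Suc j) \<omega> \<partial>M) + (\<integral>\<omega>. Z \<omega> * R (Suc j) \<omega> \<partial>M) - (\<integral>\<omega>. Z \<omega> * R j \<omega> \<partial>M)"
    using j integral_mult_A[OF _ ZS Z(2)] integral_mult_A[OF _ Z] by simp
  also have "\<dots> = (\<integral>\<omega>. Z \<omega> * X n (Suc j) \<omega> + Z \<omega> * R (Suc j) \<omega> \<partial>M) - (\<integral>\<omega>. Z \<omega> * R j \<omega> \<partial>M)"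
    using int by simp
  also have "R j = (\<lambda>\<omega>. X n (Suc j) \<omega> + R (Suc j) \<omega>)"
    unfolding R_def using j by (auto simp: sum.atLeast_Suc_atMost)
  finally show "(\<integral>\<omega>. Z \<omega> * D j \<omega> \<partial>M) = 0" by (simp add: distrib_left)
qed

section \<open>Telescoping identities and probability estimates for a row\<close>

lemma partial_sum_measurable: "partial_sum X n n \<in> borel_measurable M"
  unfolding partial_sum_def using X_measurable by (intro borel_measurable_sum) auto

lemma partial_sum_eq_sum_D: "AE \<omega> in M. partial_sum X n n \<omega> = (\<Sum>j<n. D j \<omega>)"
  using A_n AE_space
proof eventually_elim
  case (elim \<omega>)
  have "(\<Sum>j<n. D j \<omega>) = (\<Sum>j<n. X n (Suc j) \<omega>) + (\<Sum>j<n. A (Suc j) \<omega> - A j \<omega>)"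
    by (simp add: D_def sum.distrib algebra_simps flip: sum.distrib)
  also have "(\<Sum>j<n. A (Suc j) \<omega> - A j \<omega>) = 0"
    using sum_lessThan_telescope[of "\<lambda>j. A j \<omega>" n] elim A_0 by simp
  also have "(\<Sum>j<n. X n (Suc j) \<omega>) = partial_sum X n n \<omega>"
    by (simp add: partial_sum_def sum.atLeast1_atMost_eq)
  finally show ?case by simp
qed

text \<open>With X, A' the values at \<open>Suc j\<close> and A, D those at \<open>j\<close>, X + A'
  = D + A. Hence X^2 + 2XA' = (D + A)^2 - A'^2, and the squares of the remainders telescope to 0
  because \<open>A 0\<close> and, almost everywhere, \<open>A n\<close> vanish.\<close>

lemma compensated_squares_eq:
  "AE \<omega> in M. (\<Sum>j = 1..n. (X n j \<omega>)\<^sup>2 + 2 * X n j \<omega> * A j \<omega>) = qv n \<omega> + 2 * (\<Sum>j<n. A j \<omega> * D j \<omega>)"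
  using A_n AE_space
proof eventually_elim
  case (elim \<omega>)
  have "(\<Sum>j = 1..n. (X n j \<omega>)\<^sup>2 + 2 * X n j \<omega> * A j \<omega>)
      = (\<Sum>j<n. (X n (Suc j) \<omega>)\<^sup>2 + 2 * X n (Suc j) \<omega> * A (Suc j) \<omega>)"
    by (simp add: sum.atLeast1_atMost_eq)
  also have "\<dots> = (\<Sum>j<n. ((D j \<omega>)\<^sup>2 + 2 * (A j \<omega> * D j \<omega>)) - ((A (Suc j) \<omega>)\<^sup>2 - (A j \<omega>)\<^sup>2))"
    by (intro sum.cong) (auto simp: D_def power2_eq_square algebra_simps)
  also have "\<dots> = qv n \<omega> + 2 * (\<Sum>j<n. A j \<omega> * D j \<omega>) - (\<Sum>j<n. (A (Suc j) \<omega>)\<^sup>2 - (A j \<omega>)\<^sup>2)"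
    by (simp only: qv_def sum_subtractf sum.distrib sum_distrib_left)
  also have "(\<Sum>j<n. (A (Suc j) \<omega>)\<^sup>2 - (A j \<omega>)\<^sup>2) = 0"
    using sum_lessThan_telescope[of "\<lambda>j. (A j \<omega>)\<^sup>2" n] elim A_0 by simp
  finally show ?case by simp
qed

lemma D_and_A_le:
  assumes "\<omega> \<in> space M" "j < n" and max: "Max ((\<lambda>j. \<bar>X n j \<omega>\<bar> + \<bar>A j \<omega>\<bar>) ` {1..n}) \<le> m"
  shows "\<bar>A j \<omega>\<bar> \<le> m" and "\<bar>D j \<omega>\<bar> \<le> 2 * m"
proof -
  have le: "\<bar>X n i \<omega>\<bar> + \<bar>A i \<omega>\<bar> \<le> m" if "1 \<le> i" "i \<le> n" for i
    using max that by (subst (asm) Max_le_iff) auto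
  have "0 \<le> m" using le[of "Suc j"] \<open>j < n\<close> by auto
  \<comment> \<open>The maximum starts at index 1, so index 0 is covered by
    \<open>A_0\<close>.\<close>
  then show Aj: "\<bar>A j \<omega>\<bar> \<le> m"
    using le[of j] \<open>j < n\<close> A_0[OF assms(1)] by (cases "j = 0") auto
  show "\<bar>D j \<omega>\<bar> \<le> 2 * m"
    unfolding D_def using Aj le[of "Suc j"] \<open>j < n\<close> by auto
qed

lemma Max_measurable:
  "(\<lambda>\<omega>. Max ((\<lambda>j. \<bar>X n j \<omega>\<bar> + \<bar>A j \<omega>\<bar>) ` {1..n})) \<in> borel_measurable M"
  using X_measurable A_measurable by (intro borel_measurable_Max) auto

lemma compensated_squares_measurable:
  "(\<lambda>\<omega>. \<Sum>j = 1..n. (X n j \<omega>)\<^sup>2 + 2 * X n j \<omega> * A j \<omega>) \<in> borel_measurable M"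
  using X_measurable A_measurable by (intro borel_measurable_sum) auto

lemma prob_D_large_le:
  assumes "0 < \<delta>"
  shows "prob {\<omega>\<in>space M. \<exists>j<n. \<bar>D j \<omega>\<bar> > \<delta>}
    \<le> prob {\<omega>\<in>space M. \<bar>Max ((\<lambda>j. \<bar>X n j \<omega>\<bar> + \<bar>A j \<omega>\<bar>) ` {1..n}) - 0\<bar> > \<delta> / 2}"
proof (rule finite_measure_mono)
  show "{\<omega>\<in>space M. \<bar>Max ((\<lambda>j. \<bar>X n j \<omega>\<bar> + \<bar>A j \<omega>\<bar>) ` {1..n}) - 0\<bar> > \<delta> / 2} \<in> events"
    using Max_measurable by measurable
  have "\<delta> / 2 < \<bar>Max ((\<lambda>j. \<bar>X n j \<omega>\<bar> + \<bar>A j \<omega>\<bar>) ` {1..n}) - 0\<bar>" if "\<omega> \<in> space M" "j < n" "\<delta> < \<bar>D j \<omega>\<bar>" for \<omega> j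
    using D_and_A_le(2)[OF that(1,2), of "\<delta> / 2"] that(3) by linarith
  then show "{\<omega>\<in>space M. \<exists>j<n. \<bar>D j \<omega>\<bar> > \<delta>}
    \<subseteq> {\<omega>\<in>space M. \<bar>Max ((\<lambda>j. \<bar>X n j \<omega>\<bar> + \<bar>A j \<omega>\<bar>) ` {1..n}) - 0\<bar> > \<delta> / 2}"
    by blast
qed

text \<open>Outside \<open>E1\<close> the compensated sum is within \<delta>/2 of 1, outside
  \<open>E2\<close> the truncation at \<gamma> changes nothing, and outside \<open>E3\<close> twice
  the mixed sum is below \<delta>/2. So the quadratic variation can deviate by more than \<delta>
  only on their union, up to a null set.\<close>

lemma prob_qv_deviation_le:
  assumes "0 < \<delta>" "0 < \<gamma>" and variance_1: "(\<integral>\<omega>. (partial_sum X n n \<omega>)\<^sup>2 \<partial>M) = 1"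
  shows "prob {\<omega>\<in>space M. \<bar>(\<Sum>j<n. (D j \<omega>)\<^sup>2) - 1\<bar> > \<delta>}
    \<le> prob {\<omega>\<in>space M. \<bar>(\<Sum>j = 1..n. (X n j \<omega>)\<^sup>2 + 2 * X n j \<omega> * A j \<omega>) - 1\<bar> > \<delta> / 2}
      + prob {\<omega>\<in>space M. \<bar>Max ((\<lambda>j. \<bar>X n j \<omega>\<bar> + \<bar>A j \<omega>\<bar>) ` {1..n}) - 0\<bar> > \<gamma>}
      + (4 * \<gamma> / \<delta>)\<^sup>2"
proof -
  define b where "b j \<omega> = A j \<omega> * of_bool (\<bar>A j \<omega>\<bar> \<le> \<gamma>)" for j \<omega>
  define T where "T \<omega> = (\<Sum>j<n. b j \<omega> * D j \<omega>)" for \<omega>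
  define E1 where "E1 = {\<omega>\<in>space M. \<bar>(\<Sum>j = 1..n. (X n j \<omega>)\<^sup>2 + 2 * X n j \<omega> * A j \<omega>) - 1\<bar> > \<delta> / 2}"
  define E2 where "E2 = {\<omega>\<in>space M. \<bar>Max ((\<lambda>j. \<bar>X n j \<omega>\<bar> + \<bar>A j \<omega>\<bar>) ` {1..n}) - 0\<bar> > \<gamma>}"
  define E3 where "E3 = {\<omega>\<in>space M. (T \<omega>)\<^sup>2 \<ge> (\<delta> / 4)\<^sup>2}"
  have b: "b j \<in> borel_measurable (F n j)" if "j < n" for j
  proof -
    have [measurable]: "A j \<in> borel_measurable (F n j)" using A_measurable_F that by simp
    show ?thesis unfolding b_def by measurable
  qed
  have b_le: "\<bar>b j \<omega>\<bar> \<le> \<gamma>" for j \<omega>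
    using \<open>0 < \<gamma>\<close> by (auto simp: b_def)
  have "(\<Sum>j<n. \<integral>\<omega>. (D j \<omega>)\<^sup>2 \<partial>M) = (\<integral>\<omega>. (partial_sum X n n \<omega>)\<^sup>2 \<partial>M)"
    unfolding second_moment_sum[symmetric]
  proof (rule integral_cong_AE)
    show "AE \<omega> in M. (\<Sum>j<n. D j \<omega>)\<^sup>2 = (partial_sum X n n \<omega>)\<^sup>2"
      using partial_sum_eq_sum_D by eventually_elim simp
    show "(\<lambda>\<omega>. (\<Sum>j<n. D j \<omega>)\<^sup>2) \<in> borel_measurable M"
      using d_measurable by (intro borel_measurable_power borel_measurable_sum) auto
  qed (use partial_sum_measurable in measurable)
  then have ET: "(\<integral>\<omega>. (T \<omega>)\<^sup>2 \<partial>M) \<le> \<gamma>\<^sup>2"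
    using transform_second_moment_le[of b \<gamma>, OF b b_le] variance_1 by (simp add: T_def)
  have T_int: "integrable M (\<lambda>\<omega>. (T \<omega>)\<^sup>2)"
    unfolding T_def by (rule transform_second_moment(1)[of b \<gamma>, OF b b_le order_refl])
  have "b j \<in> borel_measurable M" if "j < n" for j
    using measurable_G[OF _ b[OF that]] that by simp
  then have T_meas: "T \<in> borel_measurable M"
    unfolding T_def using d_measurable by (intro borel_measurable_sum borel_measurable_times) auto
  have E: "E1 \<in> events" "E2 \<in> events" "E3 \<in> events"
    unfolding E1_def E2_def E3_def using compensated_squares_measurable Max_measurable T_meas by measurable
  \<comment> \<open>Markov's inequality for the square of \<open>T\<close>, whose mean is at most
    \<gamma>^2 because the second moments of the increments sum to 1.\<close>
  have "prob E3 \<le> (\<integral>\<omega>. (T \<omega>)\<^sup>2 \<partial>M) / (\<delta> / 4)\<^sup>2"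
    unfolding E3_def using T_int \<open>0 < \<delta>\<close>
    by (intro integral_Markov_inequality_measure[where A = "space M"]) auto
  also have "\<dots> \<le> \<gamma>\<^sup>2 / (\<delta> / 4)\<^sup>2"
    using ET by (intro divide_right_mono) auto
  also have "\<dots> = (4 * \<gamma> / \<delta>)\<^sup>2" by (simp add: power_divide power_mult_distrib)
  finally have E3_le: "prob E3 \<le> (4 * \<gamma> / \<delta>)\<^sup>2" .
  have "prob {\<omega>\<in>space M. \<bar>(\<Sum>j<n. (D j \<omega>)\<^sup>2) - 1\<bar> > \<delta>} \<le> prob (E1 \<union> E2 \<union> E3)"
  proof (rule finite_measure_mono_AE)
    show "AE \<omega> in M. \<omega> \<in> {\<omega>\<in>space M. \<bar>(\<Sum>j<n. (D j \<omega>)\<^sup>2) - 1\<bar> > \<delta>} \<longrightarrow> \<omega> \<in> E1 \<union> E2 \<union> E3"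
      using compensated_squares_eq AE_space
    proof (eventually_elim, intro impI)
      fix \<omega> assume sum: "(\<Sum>j = 1..n. (X n j \<omega>)\<^sup>2 + 2 * X n j \<omega> * A j \<omega>)
          = qv n \<omega> + 2 * (\<Sum>j<n. A j \<omega> * D j \<omega>)" and \<omega>: "\<omega> \<in> space M"
        and "\<omega> \<in> {\<omega>\<in>space M. \<bar>(\<Sum>j<n. (D j \<omega>)\<^sup>2) - 1\<bar> > \<delta>}"
      then have dev: "\<bar>qv n \<omega> - 1\<bar> > \<delta>" by (simp add: qv_def)
      show "\<omega> \<in> E1 \<union> E2 \<union> E3"
      proof (rule ccontr)
        assume not: "\<omega> \<notin> E1 \<union> E2 \<union> E3"
        then have max: "Max ((\<lambda>j. \<bar>X n j \<omega>\<bar> + \<bar>A j \<omega>\<bar>) ` {1..n}) \<le> \<gamma>"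
          using \<omega> unfolding E2_def by auto
        have T: "T \<omega> = (\<Sum>j<n. A j \<omega> * D j \<omega>)"
          unfolding T_def b_def using D_and_A_le(1)[OF \<omega> _ max] by (intro sum.cong) auto
        have "(T \<omega>)\<^sup>2 < (\<delta> / 4)\<^sup>2"
          using not \<omega> unfolding E3_def by auto
        then have "\<bar>T \<omega>\<bar> < \<delta> / 4"
          using \<open>0 < \<delta>\<close> power2_less_imp_less[of "\<bar>T \<omega>\<bar>" "\<delta> / 4"] by simp
        moreover have "\<bar>qv n \<omega> + 2 * T \<omega> - 1\<bar> \<le> \<delta> / 2"
        proof -
          have "\<not> \<delta> / 2 < \<bar>(\<Sum>j = 1..n. (X n j \<omega>)\<^sup>2 + 2 * X n j \<omega> * A j \<omega>) - 1\<bar>"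
            using not \<omega> unfolding E1_def by blast
          then show ?thesis unfolding sum T by (simp only: not_less)
        qed
        ultimately show False using dev by linarith
      qed
    qed
  qed (use E in auto)
  also have "\<dots> \<le> prob E1 + prob E2 + prob E3"
    using measure_Un_le[of "E1 \<union> E2" M E3] measure_Un_le[of E1 M E2] E by auto
  finally show ?thesis
    using E3_le unfolding E1_def E2_def by simp
qed

end

section \<open>Convergence of the adapted array to the normal law\<close>

theorem theorem11:
  fixes M :: "'a measure"
    and F :: "nat \<Rightarrow> nat \<Rightarrow> 'a measure"
    and X :: "nat \<Rightarrow> nat \<Rightarrow> 'a \<Rightarrow> real"
  assumes "prob_space M"
    and subalg: "\<And>n j. 1 \<le> j \<Longrightarrow> j \<le> n \<Longrightarrow> subalgebra M (F n j)"
    and mono: "\<And>n j. 1 \<le> j \<Longrightarrow> j \<le> n - 1 \<Longrightarrow> sets (F n j) \<subseteq> sets (F n (j + 1))"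
    and F_0: "\<And>n. 1 \<le> n \<Longrightarrow> space (F n 0) = space M \<and> sets (F n 0) = {{}, space M}"
    and X_0: "\<And>n \<omega>. 1 \<le> n \<Longrightarrow> \<omega> \<in> space M \<Longrightarrow> X n 0 \<omega> = 0"
    and adapted: "\<And>n j. 1 \<le> j \<Longrightarrow> j \<le> n \<Longrightarrow> X n j \<in> borel_measurable (F n j)"
    and square_integrable: "\<And>n j. 1 \<le> j \<Longrightarrow> j \<le> n \<Longrightarrow> integrable M (\<lambda>\<omega>. (X n j \<omega>)\<^sup>2)"
    and centered: "\<And>n j. 1 \<le> j \<Longrightarrow> j \<le> n \<Longrightarrow> (\<integral>\<omega>. X n j \<omega> \<partial>M) = 0"
    and variance_1: "\<And>n. 1 \<le> n \<Longrightarrow> (\<integral>\<omega>. (partial_sum X n n \<omega>)\<^sup>2 \<partial>M) = 1"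
    and max_small: "tendsto_in_prob M
          (\<lambda>n \<omega>. Max ((\<lambda>j. \<bar>X n j \<omega>\<bar> + \<bar>cond_remainder M F X n j \<omega>\<bar>) ` {1..n}))
          (\<lambda>\<omega>. 0)"
    and sum_to_1: "tendsto_in_prob M
          (\<lambda>n \<omega>. \<Sum>j = 1..n. (X n j \<omega>)\<^sup>2 + 2 * X n j \<omega> * cond_remainder M F X n j \<omega>)
          (\<lambda>\<omega>. 1)"
  shows "weak_conv_m (\<lambda>n. distr M borel (partial_sum X n n)) std_normal_distribution"
proof -
  interpret prob_space M by fact
  have row: "adapted_row M F X n" if "1 \<le> n" for n
    by unfold_locales (use that subalg mono F_0 adapted square_integrable centered in auto)
  define Y where "Y n = adapted_row.D M F X n" for n
  define m where "m \<gamma> n = prob {\<omega>\<in>space M.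
      \<bar>Max ((\<lambda>j. \<bar>X n j \<omega>\<bar> + \<bar>cond_remainder M F X n j \<omega>\<bar>) ` {1..n}) - 0\<bar> > \<gamma>}" for \<gamma> n
  define s where "s \<gamma> n = prob {\<omega>\<in>space M.
      \<bar>(\<Sum>j = 1..n. (X n j \<omega>)\<^sup>2 + 2 * X n j \<omega> * cond_remainder M F X n j \<omega>) - 1\<bar> > \<gamma>}" for \<gamma> n
  have m: "m \<gamma> \<longlonglongrightarrow> 0" and s: "s \<gamma> \<longlonglongrightarrow> 0" if "0 < \<gamma>" for \<gamma>
    using max_small sum_to_1 that unfolding tendsto_in_prob_def m_def s_def by auto
  show ?thesis
  proof (rule martingale_central_limit_theorem)
    show "mds_row M (F n) (Y n) n" if "1 \<le> n" for n
    proof -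
      interpret adapted_row M F X n by (rule row) fact
      show ?thesis unfolding Y_def by (rule mds_row_axioms)
    qed
    show "AE \<omega> in M. partial_sum X n n \<omega> = (\<Sum>j<n. Y n j \<omega>)" if "1 \<le> n" for n
      unfolding Y_def by (rule adapted_row.partial_sum_eq_sum_D[OF row[OF that]])
    show "partial_sum X n n \<in> borel_measurable M" for n
    \<comment> \<open>The hypotheses begin at n = 1; for n = 0 the sum is empty and
      constant.\<close>
    proof (cases "n = 0")
      case True
      then show ?thesis by (simp add: partial_sum_def)
    next
      case False
      then show ?thesis using adapted_row.partial_sum_measurable[OF row[of n]] by simp
    qed
    show "(\<integral>\<omega>. (partial_sum X n n \<omega>)\<^sup>2 \<partial>M) = 1" if "1 \<le> n" for n
      using that by (rule variance_1)
    show "(\<lambda>n. prob {\<omega>\<in>space M. \<exists>j<n. \<bar>Y n j \<omega>\<bar> > \<delta>}) \<longlonglongrightarrow> 0" if "0 < \<delta>" for \<delta>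
    proof (rule tendsto_sandwich[OF _ _ tendsto_const])
      show "m (\<delta> / 2) \<longlonglongrightarrow> 0" using m that by simp
      show "\<forall>\<^sub>F n in sequentially. prob {\<omega>\<in>space M. \<exists>j<n. \<bar>Y n j \<omega>\<bar> > \<delta>} \<le> m (\<delta> / 2) n"
        using eventually_ge_at_top[of 1]
        by eventually_elim (unfold Y_def m_def, rule adapted_row.prob_D_large_le[OF row that])
    qed simp
    show "tendsto_in_prob M (\<lambda>n \<omega>. \<Sum>j<n. (Y n j \<omega>)\<^sup>2) (\<lambda>_. 1)"
      unfolding tendsto_in_prob_def
    proof (intro allI impI tendstoI)
      fix \<delta> e :: real assume "0 < \<delta>" "0 < e"
      \<comment> \<open>Chosen so that the Markov term equals e/2; the two probabilities share the
        other half for large \<open>n\<close>.\<close>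
      define \<gamma> where "\<gamma> = \<delta> / 4 * sqrt (e / 2)"
      have \<gamma>: "0 < \<gamma>" "(4 * \<gamma> / \<delta>)\<^sup>2 = e / 2"
        using \<open>0 < \<delta>\<close> \<open>0 < e\<close> by (auto simp: \<gamma>_def)
      have "(\<lambda>n. s (\<delta> / 2) n + m \<gamma> n) \<longlonglongrightarrow> 0 + 0"
        using s m \<open>0 < \<delta>\<close> \<gamma> by (intro tendsto_add) auto
      then have "\<forall>\<^sub>F n in sequentially. s (\<delta> / 2) n + m \<gamma> n < e / 2"
        using \<open>0 < e\<close> by (intro order_tendstoD(2)) auto
      then show "\<forall>\<^sub>F n in sequentially.
          dist (prob {\<omega>\<in>space M. \<bar>(\<Sum>j<n. (Y n j \<omega>)\<^sup>2) - 1\<bar> > \<delta>}) 0 < e"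
        using eventually_ge_at_top[of 1]
      proof eventually_elim
        case (elim n)
        have "prob {\<omega>\<in>space M. \<bar>(\<Sum>j<n. (Y n j \<omega>)\<^sup>2) - 1\<bar> > \<delta>}
            \<le> s (\<delta> / 2) n + m \<gamma> n + (4 * \<gamma> / \<delta>)\<^sup>2"
          unfolding Y_def s_def m_def
          by (rule adapted_row.prob_qv_deviation_le[OF row[OF elim(2)] \<open>0 < \<delta>\<close> \<gamma>(1) variance_1[OF elim(2)]])
        then show ?case using elim \<gamma> by simp
      qed
    qed
  qed
qed

end
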